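(* Let $C_\infty=C(X_\infty)\in\mathbb R^{d\times d}$ be the limiting empirical covariance (see context), $\mathcal V_\infty:=\operatorname{Range}(C_\infty)$, and assume that $A$ is positive definite on $\mathcal V_\infty$. Let $x^\dagger\in\mathbb R^d$ satisfy $$C_\infty(Ax^\dagger-b)=0.$$ Let $\bar x:[0,\infty)\to\mathbb R^d$ solve the frozen-covariance mean dynamics $$\ddot{\bar x}(t)+\gamma\dot{\bar x}(t)=-\beta C_\infty(A\bar x(t)-b),$$ and assume that $$\bar x(0)-x^\dagger\in\mathcal V_\infty,\qquad \dot{\bar x}(0)\in\mathcal V_\infty.$$ Then the error $r(t):=\bar x(t)-x^\dagger$ decays exponentially to zero along the retained directions, i.e. $r(t)\in\mathcal V_\infty$ for all $t\ge0$ and there exist constants $M,\omega>0$ such that $\|r(t)\|\le Me^{-\omega t}$ for all $t\ge0$.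
   Context: $G\in\mathbb R^{K\times d}$ is a matrix, $\Gamma\in\mathbb R^{K\times K}$ is symmetric positive definite, $y\in\mathbb R^K$, $A:=G^T\Gamma^{-1}G$, $b:=G^T\Gamma^{-1}y$; $\gamma>0$, $\beta>0$. $\|\cdot\|$ is the Euclidean norm. For an ensemble $X=\{x_j\}_{j=1}^J$ in $\mathbb R^d$ with mean $\bar x=\frac1J\sum_jx_j$, the empirical covariance is $C(X)=\frac1J\sum_{j=1}^J(x_j-\bar x)(x_j-\bar x)^T$, a symmetric positive semidefinite matrix. The ensemble $X_\infty$ is the limit of a global solution $(X(t),\dot X(t))\to(X_\infty,0)$, $t\to\infty$, of $$\ddot x_j+\gamma\dot x_j=-\beta C(X)(Ax_j-b)+k\sum_{i\neq j}f(\|x_i-x_j\|)(x_j-x_i)-\alpha(x_j-\bar x),\quad j=1,\dots,J,$$ with $k,\alpha\ge0$ and $f:[0,\infty)\to(0,\infty)$ smooth and non-increasing. In the frozen-covariance equation the matrix $C_\infty$ is constant in time, and $\bar x(t)$ there denotes the solution of that linear equation (not the mean of the full particle system). "$A$ is positive definite on $\mathcal V_\infty$" means $v^TAv>0$ for all nonzero $v\in\mathcal V_\infty$. The vectors in $\mathcal V_\infty$ are called the retained directions. *)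

theory Defs
  imports "HOL-Analysis.Analysis"
begin

definition pos_def_on :: "real ^ 'n ^ 'n \<Rightarrow> (real ^ 'n) set \<Rightarrow> bool" where
  "pos_def_on M V \<longleftrightarrow> (\<forall>v\<in>V. v \<noteq> 0 \<longrightarrow> v \<bullet> (M *v v) > 0)"

definition sym_pos_def :: "real ^ 'n ^ 'n \<Rightarrow> bool" where
  "sym_pos_def M \<longleftrightarrow> transpose M = M \<and> pos_def_on M UNIV"

definition hess :: "real ^ 'd ^ 'k \<Rightarrow> real ^ 'k ^ 'k \<Rightarrow> real ^ 'd ^ 'd" where
  "hess G \<Gamma> = transpose G ** matrix_inv \<Gamma> ** G"

definition rhs_vec :: "real ^ 'd ^ 'k \<Rightarrow> real ^ 'k ^ 'k \<Rightarrow> real ^ 'k \<Rightarrow> real ^ 'd" where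
  "rhs_vec G \<Gamma> y = transpose G *v (matrix_inv \<Gamma> *v y)"

text \<open>An ensemble of \<open>J = CARD('j)\<close> particles in \<open>\<real>\<^sup>d\<close> is a vector \<open>X :: real ^ 'd ^ 'j\<close>;
  particle \<open>j\<close> is \<open>X $ j\<close>.\<close>

definition ens_mean :: "real ^ 'd ^ 'j \<Rightarrow> real ^ 'd" where
  "ens_mean X = (1 / real CARD('j)) *\<^sub>R (\<Sum>j\<in>UNIV. X $ j)"

definition emp_cov :: "real ^ 'd ^ 'j \<Rightarrow> real ^ 'd ^ 'd" where
  "emp_cov X = (1 / real CARD('j)) *\<^sub>R
     (\<Sum>j\<in>UNIV. \<chi> p q. (X $ j - ens_mean X) $ p * (X $ j - ens_mean X) $ q)"

definition retained :: "real ^ 'd ^ 'j \<Rightarrow> (real ^ 'd) set" where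
  "retained X = range (\<lambda>v. emp_cov X *v v)"

text \<open>Smoothness on the closed half-line: derivatives of all orders exist on \<open>[0,\<infinity>)\<close>, one-sided
  at \<open>0\<close>; \<open>D n\<close> is the \<open>n\<close>-th derivative. Values of \<open>f\<close> at negative arguments are irrelevant.\<close>

definition smooth_halfline :: "(real \<Rightarrow> real) \<Rightarrow> bool" where
  "smooth_halfline f \<longleftrightarrow>
     (\<exists>D :: nat \<Rightarrow> real \<Rightarrow> real. (\<forall>s\<ge>0. D 0 s = f s) \<and>
        (\<forall>n. \<forall>s\<ge>0. (D n has_real_derivative D (Suc n) s) (at s within {0..})))"

definition particle_force ::
  "real ^ 'd ^ 'd \<Rightarrow> real ^ 'd \<Rightarrow> real \<Rightarrow> real \<Rightarrow> real \<Rightarrow> (real \<Rightarrow> real)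
     \<Rightarrow> real ^ 'd ^ 'j \<Rightarrow> real ^ 'd ^ 'j" where
  "particle_force A b \<beta> k \<alpha> f X =
     (\<chi> j. - \<beta> *\<^sub>R (emp_cov X *v (A *v (X $ j) - b))
         + k *\<^sub>R (\<Sum>i\<in>UNIV - {j}. f (norm (X $ i - X $ j)) *\<^sub>R (X $ j - X $ i))
         - \<alpha> *\<^sub>R (X $ j - ens_mean X))"

text \<open>\<open>x\<close> is a global solution on \<open>[0,\<infinity>)\<close>, with velocity \<open>v = x'\<close>, of
  \<open>x'' + \<gamma> x' = F(x)\<close>; derivatives at \<open>0\<close> are one-sided.\<close>

definition damped_solution ::
  "real \<Rightarrow> ('a :: real_normed_vector \<Rightarrow> 'a) \<Rightarrow> (real \<Rightarrow> 'a) \<Rightarrow> (real \<Rightarrow> 'a) \<Rightarrow> bool" where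
  "damped_solution \<gamma> F x v \<longleftrightarrow>
     (\<forall>t\<ge>0. (x has_vector_derivative v t) (at t within {0..}) \<and>
       (\<exists>a. (v has_vector_derivative a) (at t within {0..}) \<and> a + \<gamma> *\<^sub>R v t = F (x t)))"

end

(* Let B be the inner product induced on the retained space V by an inverse of the symmetric
   map C on its range V, and write r for the error and v for its derivative. V is invariant:
   for w in the kernel of C, which is the orthogonal complement of V, the function
   u = w . r solves u'' + g u' = 0 with zero data. On V the energy

     E = B(v,v)/2 + (beta/2) r.Ar + (g/2) B(r,v) + (g^2/4) B(r,r)

   satisfies E' = - (g/2) B(v,v) - (g beta/2) r.Ar. The cross term is chosen so that E is still
   bounded below by (beta/2) r.Ar and above by a multiple of B(v,v) + r.Ar, so E decays
   exponentially, and r.Ar dominates the square of the norm of r on V. *)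

theory Submission
  imports Defs
begin

section \<open>Symmetry of the Hessian; symmetry and semidefiniteness of the covariance\<close>

lemma inner_symmetric_matrix:
  fixes M :: "real ^ 'n ^ 'n"
  assumes "transpose M = M"
  shows "x \<bullet> (M *v y) = (M *v x) \<bullet> y"
  by (metis assms dot_lmul_matrix vector_transpose_matrix)

text \<open>Only the inverse of \<open>\<Gamma>\<close> needs work. Definiteness gives a trivial
  kernel, hence invertibility; transposing \<open>\<Gamma> ** matrix_inv \<Gamma> = mat 1\<close>
  shows that the transposed inverse is a left inverse of \<open>\<Gamma>\<close>, and a left inverse
  coincides with a right inverse.\<close>

lemma transpose_hess:
  assumes "sym_pos_def \<Gamma>"
  shows "transpose (hess G \<Gamma>) = hess G \<Gamma>"
proof -
  have sym: "transpose \<Gamma> = \<Gamma>" and pd: "\<And>v. v \<noteq> 0 \<Longrightarrow> v \<bullet> (\<Gamma> *v v) > 0"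
    using assms by (auto simp: sym_pos_def_def pos_def_on_def)
  have "\<And>v. \<Gamma> *v v = 0 \<Longrightarrow> v = 0"
    using pd by (metis inner_zero_right less_irrefl)
  then have "invertible \<Gamma>"
    by (metis invertible_left_inverse matrix_left_invertible_ker)
  then have inv: "\<Gamma> ** matrix_inv \<Gamma> = mat 1"
    unfolding invertible_def matrix_inv_def by (rule someI2_ex) blast
  have "transpose (matrix_inv \<Gamma>) ** \<Gamma> = mat 1"
    by (metis inv matrix_transpose_mul sym transpose_mat)
  then have "transpose (matrix_inv \<Gamma>) = matrix_inv \<Gamma>"
    by (metis inv matrix_mul_assoc matrix_mul_lid matrix_mul_rid)
  then show ?thesis
    by (simp add: hess_def matrix_transpose_mul matrix_mul_assoc)
qed

lemma transpose_emp_cov: "transpose (emp_cov X) = emp_cov X"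
  by (simp add: emp_cov_def transpose_def vec_eq_iff mult.commute)

text \<open>The quadratic form is the empirical variance of the ensemble in direction
  \<open>w\<close>, a mean of squares over the particles.\<close>

lemma emp_cov_nonneg: "w \<bullet> (emp_cov X *v w) \<ge> 0"
  for X :: "real ^ 'd ^ 'j"
proof -
  let ?x = "\<lambda>j. X $ j - ens_mean X"
  have "w \<bullet> (emp_cov X *v w)
      = (1 / real CARD('j)) * (\<Sum>p\<in>UNIV. \<Sum>q\<in>UNIV. \<Sum>j\<in>UNIV. (?x j $ p * w $ p) * (?x j $ q * w $ q))"
    by (simp add: emp_cov_def inner_vec_def matrix_vector_mult_def sum_distrib_left
        sum_distrib_right sum_divide_distrib mult_ac)
  also have "(\<Sum>p\<in>UNIV. \<Sum>q\<in>UNIV. \<Sum>j\<in>UNIV. (?x j $ p * w $ p) * (?x j $ q * w $ q))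
      = (\<Sum>j\<in>UNIV. \<Sum>p\<in>UNIV. \<Sum>q\<in>UNIV. (?x j $ p * w $ p) * (?x j $ q * w $ q))"
    \<comment> \<open>The particle index moves outwards in two swaps: past \<open>q\<close> under
      the sum over \<open>p\<close>, then past \<open>p\<close>.\<close>
    by (rule trans[OF sum.cong[OF refl sum.swap] sum.swap])
  also have "\<dots> = (\<Sum>j\<in>UNIV. (?x j \<bullet> w)\<^sup>2)"
    by (simp add: inner_vec_def power2_eq_square sum_product)
  finally show ?thesis
    by (simp add: sum_nonneg)
qed

section \<open>Coercivity on a subspace, and decay from a differential inequality\<close>

lemma pos_def_on_coercive:
  fixes V :: "(real ^ 'n) set"
  assumes V: "subspace V" and M: "pos_def_on M V"
  obtains m where "m > 0" "\<And>x. x \<in> V \<Longrightarrow> m * (x \<bullet> x) \<le> x \<bullet> (M *v x)"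
proof (cases "V \<inter> sphere 0 1 = {}")
  case True
  \<comment> \<open>An empty unit sphere means that \<open>V\<close> is trivial; the bound then
    reads 0 \<le> 0 and any positive constant serves.\<close>
  have "x = 0" if "x \<in> V" for x
  proof (rule ccontr)
    assume "x \<noteq> 0"
    then have "(1 / norm x) *\<^sub>R x \<in> V \<inter> sphere 0 1"
      using that V by (simp add: subspace_scale)
    with True show False by blast
  qed
  then show ?thesis
    using that[of 1] by force
next
  case False
  \<comment> \<open>The form is homogeneous of degree two, so its minimum over the unit sphere of
    \<open>V\<close> is the constant sought; it is attained, hence positive.\<close>
  have "compact (V \<inter> sphere 0 1)"
    using V by (simp add: closed_Int_compact closed_subspace)
  moreover have "continuous_on (V \<inter> sphere 0 1) (\<lambda>x. x \<bullet> (M *v x))"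
    by (intro continuous_intros linear_continuous_on) (simp add: linear_conv_bounded_linear[symmetric])
  ultimately obtain z where z: "z \<in> V \<inter> sphere 0 1"
      and le: "\<And>x. x \<in> V \<inter> sphere 0 1 \<Longrightarrow> z \<bullet> (M *v z) \<le> x \<bullet> (M *v x)"
    using continuous_attains_inf[OF _ False] by blast
  show ?thesis
  proof (rule that)
    have "z \<noteq> 0" using z by auto
    then show "z \<bullet> (M *v z) > 0"
      using z M by (auto simp: pos_def_on_def)
    fix x assume x: "x \<in> V"
    show "z \<bullet> (M *v z) * (x \<bullet> x) \<le> x \<bullet> (M *v x)"
    proof (cases "x = 0")
      case False
      then have "(1 / norm x) *\<^sub>R x \<in> V \<inter> sphere 0 1"
        using x V by (simp add: subspace_scale)
      from le[OF this] False show ?thesis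
        by (simp add: matrix_vector_mult_scaleR dot_square_norm field_simps power2_eq_square)
    qed simp
  qed
qed

text \<open>Gronwall's argument: multiplied by the integrating factor
  \<open>exp (\<omega> * t)\<close>, \<open>E\<close> becomes non-increasing.\<close>

lemma exp_decay_if_derivative_le:
  fixes E E' :: "real \<Rightarrow> real"
  assumes der: "\<And>t. t \<ge> 0 \<Longrightarrow> (E has_real_derivative E' t) (at t within {0..})"
    and le: "\<And>t. t \<ge> 0 \<Longrightarrow> E' t \<le> - \<omega> * E t"
    and t: "t \<ge> 0"
  shows "E t \<le> E 0 * exp (- \<omega> * t)"
proof -
  define H where "H t = E t * exp (\<omega> * t)" for t
  have H: "(H has_real_derivative (E' s + \<omega> * E s) * exp (\<omega> * s)) (at s within {0..})"
    if "s \<ge> 0" for s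
    unfolding H_def using der[OF that]
    by (auto intro!: derivative_eq_intros simp: algebra_simps)
  have "H t \<le> H 0"
  proof (rule DERIV_nonpos_imp_decreasing_open[OF t])
    fix s :: real assume s: "0 < s" "s < t"
    \<comment> \<open>The monotonicity rule wants two-sided derivatives, but only in the open
      interval; the endpoint 0 is covered by continuity.\<close>
    then have "at s within {0..} = at s"
      by (intro at_within_interior) simp
    then show "\<exists>y. DERIV H s :> y \<and> y \<le> 0"
      using H[of s] le[of s] s by (auto simp: mult_nonpos_nonneg intro!: exI conjI)
  next
    show "continuous_on {0..t} H"
      by (rule continuous_on_subset[of "{0..}"])
        (auto intro!: DERIV_continuous_on H)
  qed
  then show ?thesis
    by (simp add: H_def exp_minus field_simps)
qed

section \<open>Invariance of the range under the dynamics\<close>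

lemma range_symmetric_matrixI:
  fixes M :: "real ^ 'n ^ 'n"
  assumes sym: "transpose M = M" and orth: "\<And>w. M *v w = 0 \<Longrightarrow> w \<bullet> x = 0"
  shows "x \<in> range (\<lambda>w. M *v w)"
proof -
  have sub: "subspace (range (\<lambda>w. M *v w))"
    by (intro linear_subspace_image) auto
  obtain y z where y: "y \<in> range (\<lambda>w. M *v w)"
    and z: "\<And>w. w \<in> range (\<lambda>w. M *v w) \<Longrightarrow> orthogonal z w" and xyz: "x = y + z"
    using orthogonal_subspace_decomp_exists[of "range (\<lambda>w. M *v w)" x] sub
    by (metis span_eq_iff)
  \<comment> \<open>The component \<open>z\<close> orthogonal to the range lies in the kernel, so
    \<open>orth\<close> applies to \<open>z\<close> itself and forces it to vanish.\<close>
  have "(M *v z) \<bullet> (M *v z) = z \<bullet> (M *v (M *v z))"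
    by (rule inner_symmetric_matrix[OF sym, symmetric])
  also have "\<dots> = 0"
    using z by (auto simp: orthogonal_def)
  finally have "z \<bullet> x = 0"
    using orth by simp
  moreover have "z \<bullet> y = 0"
    using z[OF y] by (simp add: orthogonal_def)
  ultimately have "z = 0"
    by (simp add: xyz inner_add_right)
  then show ?thesis
    using y xyz by simp
qed

text \<open>The force enters only through its values lying in the range of \<open>C\<close>, so
  \<open>F\<close> is left arbitrary: against a kernel vector the force disappears and pure damping
  remains. The velocity is included because the energy estimate evaluates its form on it
  too.\<close>

lemma damped_solution_range_invariant:
  fixes C :: "real ^ 'n ^ 'n"
  assumes sym: "transpose C = C"
    and sol: "damped_solution \<gamma> (\<lambda>x. C *v F x) r v"
    and r0: "r 0 \<in> range (\<lambda>w. C *v w)" and v0: "v 0 \<in> range (\<lambda>w. C *v w)"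
    and t: "t \<ge> 0"
  shows "r t \<in> range (\<lambda>w. C *v w)" and "v t \<in> range (\<lambda>w. C *v w)"
proof -
  have "w \<bullet> v t = 0 \<and> w \<bullet> r t = 0" if w: "C *v w = 0" for w
  proof -
    have orth: "w \<bullet> (C *v x) = 0" for x
      by (simp add: inner_symmetric_matrix[OF sym] w)
    \<comment> \<open>With the integrating factor \<open>exp (\<gamma> * t)\<close>, the damping
      equation for \<open>w \<bullet> v t\<close> becomes a conservation law; the initial velocity
      makes the constant zero.\<close>
    have "((\<lambda>t. exp (\<gamma> * t) * (w \<bullet> v t)) has_real_derivative 0) (at s within {0..})"
      if s: "s \<in> {0..}" for s
    proof -
      obtain a where a: "(v has_vector_derivative a) (at s within {0..})"
        and eq: "a + \<gamma> *\<^sub>R v s = C *v F (r s)"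
        using sol s by (auto simp: damped_solution_def)
      have "w \<bullet> a + \<gamma> * (w \<bullet> v s) = w \<bullet> (a + \<gamma> *\<^sub>R v s)"
        by (simp add: inner_add_right)
      then have "w \<bullet> a = - \<gamma> * (w \<bullet> v s)"
        by (simp add: eq orth)
      moreover have "((\<lambda>t. w \<bullet> v t) has_real_derivative w \<bullet> a) (at s within {0..})"
        using bounded_linear.has_vector_derivative[OF bounded_linear_inner_right a]
        by (simp add: has_real_derivative_iff_has_vector_derivative)
      ultimately show ?thesis
        by (auto intro!: derivative_eq_intros)
    qed
    from has_field_derivative_zero_constant[OF convex_real_interval(1) this]
    obtain c where c: "\<And>s. s \<in> {0..} \<Longrightarrow> exp (\<gamma> * s) * (w \<bullet> v s) = c"
      by blast
    have "c = 0"
      using c[of 0] v0 orth by auto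
    then have wv: "w \<bullet> v s = 0" if "s \<ge> 0" for s
      using c[of s] that by auto
    \<comment> \<open>Since the velocity has no component along \<open>w\<close>, the position's
      component is constant, and it starts at zero.\<close>
    have "((\<lambda>t. w \<bullet> r t) has_real_derivative 0) (at s within {0..})" if "s \<in> {0..}" for s
      using bounded_linear.has_vector_derivative[OF bounded_linear_inner_right, of r "v s" "at s within {0..}" w]
        sol that wv[of s]
      by (simp add: has_real_derivative_iff_has_vector_derivative damped_solution_def)
    from has_field_derivative_zero_constant[OF convex_real_interval(1) this]
    obtain d where d: "\<And>s. s \<in> {0..} \<Longrightarrow> w \<bullet> r s = d"
      by blast
    moreover have "d = 0"
      using d[of 0] r0 orth by auto
    ultimately show ?thesis
      using wv t by simp
  qed
  then show "r t \<in> range (\<lambda>w. C *v w)" "v t \<in> range (\<lambda>w. C *v w)"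
    using range_symmetric_matrixI[OF sym] by blast+
qed

section \<open>Energy decay on the range\<close>

lemma damped_preconditioned_exp_decay:
  fixes A C :: "real ^ 'n ^ 'n"
  defines "V \<equiv> range (\<lambda>w. C *v w)"
  assumes symC: "transpose C = C" and psd: "\<And>w. w \<bullet> (C *v w) \<ge> 0"
    and symA: "transpose A = A" and pd: "pos_def_on A V"
    and pos: "\<gamma> > 0" "\<beta> > 0"
    and sol: "damped_solution \<gamma> (\<lambda>x. - \<beta> *\<^sub>R (C *v (A *v x))) r v"
    and V: "\<And>t. t \<ge> 0 \<Longrightarrow> r t \<in> V" "\<And>t. t \<ge> 0 \<Longrightarrow> v t \<in> V"
  shows "\<exists>M>0. \<exists>\<omega>>0. \<forall>t\<ge>0. norm (r t) \<le> M * exp (- \<omega> * t)"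
proof -
  have subV: "subspace V"
    unfolding V_def by (intro linear_subspace_image) auto
  obtain m where m: "m > 0" "\<And>x. x \<in> V \<Longrightarrow> m * (x \<bullet> x) \<le> x \<bullet> (A *v x)"
    using pos_def_on_coercive[OF subV pd] by blast
  \<comment> \<open>A linear right inverse of \<open>C\<close> on \<open>V\<close> realises the
    inner product B(x,y) as \<open>x \<bullet> g y\<close> for \<open>x\<close>, \<open>y\<close> in
    \<open>V\<close>.\<close>
  obtain g where g: "linear g" "\<And>x. x \<in> V \<Longrightarrow> C *v (g x) = x"
    unfolding V_def
    using linear_exists_right_inverse_on[OF matrix_vector_mul_linear subspace_UNIV, of C] by auto
  have C_g: "(C *v x) \<bullet> g y = x \<bullet> y" if "y \<in> V" for x y
    using inner_symmetric_matrix[OF symC, of x "g y"] g(2)[OF that] by simp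
  have g_sym: "x \<bullet> g y = y \<bullet> g x" if "x \<in> V" "y \<in> V" for x y
    using C_g[OF \<open>y \<in> V\<close>, of "g x"] g(2)[OF \<open>x \<in> V\<close>] by (simp add: inner_commute)
  have g_nonneg: "x \<bullet> g x \<ge> 0" if "x \<in> V" for x
    using psd[of "g x"] g(2)[OF that] by (simp add: inner_commute)
  have blg: "bounded_linear g"
    using g(1) by (simp add: linear_conv_bounded_linear)
  obtain K where K: "K > 0" "\<And>x. norm (g x) \<le> norm x * K"
    using bounded_linear.pos_bounded[OF blg] by blast
  \<comment> \<open>Boundedness of \<open>g\<close> compares B(x,x) with the squared norm, which
    coercivity of \<open>A\<close> on \<open>V\<close> controls.\<close>
  have g_le: "x \<bullet> g x \<le> K / m * (x \<bullet> (A *v x))" if "x \<in> V" for x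
  proof -
    have "x \<bullet> g x \<le> norm x * norm (g x)"
      by (rule norm_cauchy_schwarz)
    also have "\<dots> \<le> norm x * (norm x * K)"
      by (intro mult_left_mono K(2)) simp
    also have "\<dots> = K / m * (m * (x \<bullet> x))"
      using m(1) by (simp add: dot_square_norm power2_eq_square)
    also have "\<dots> \<le> K / m * (x \<bullet> (A *v x))"
      using K m(1) m(2)[OF that] by (intro mult_left_mono) auto
    finally show ?thesis .
  qed
  \<comment> \<open>Differentiating the term with weight \<open>\<gamma> / 2\<close> produces
    -(\<open>\<gamma>\<^sup>2 / 2\<close>) B(r,v) through the damping; the weight
    \<open>\<gamma>\<^sup>2 / 4\<close> on B(r,r) cancels exactly this.\<close>
  define E where "E t = v t \<bullet> g (v t) / 2 + \<beta> / 2 * (r t \<bullet> (A *v r t))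
    + \<gamma> / 2 * (r t \<bullet> g (v t)) + \<gamma>\<^sup>2 / 4 * (r t \<bullet> g (r t))" for t
  define E' where "E' t = - (\<gamma> / 2) * (v t \<bullet> g (v t)) - \<gamma> * \<beta> / 2 * (r t \<bullet> (A *v r t))" for t
  have E_deriv: "(E has_real_derivative E' t) (at t within {0..})" if t: "t \<ge> 0" for t
  proof -
    obtain a where dv: "(v has_vector_derivative a) (at t within {0..})"
      and eq: "a + \<gamma> *\<^sub>R v t = - \<beta> *\<^sub>R (C *v (A *v r t))"
      using sol t by (auto simp: damped_solution_def)
    have a: "a = - \<beta> *\<^sub>R (C *v (A *v r t)) - \<gamma> *\<^sub>R v t"
      using arg_cong[OF eq, of "\<lambda>x. x - \<gamma> *\<^sub>R v t"] by simp
    have dr: "(r has_vector_derivative v t) (at t within {0..})"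
      using sol t by (simp add: damped_solution_def)
    have aV: "a \<in> V"
      unfolding a using V(2)[OF t] subV
      by (intro subspace_diff subspace_scale) (auto simp: V_def)
    \<comment> \<open>Pairing with \<open>g\<close> cancels the preconditioner \<open>C\<close>,
      leaving the gradient term of the potential \<open>r \<bullet> (A *v r)\<close>.\<close>
    have ag: "a \<bullet> g x = - \<gamma> * (v t \<bullet> g x) - \<beta> * (x \<bullet> (A *v r t))" if "x \<in> V" for x
      by (simp add: a inner_diff_left C_g[OF that] inner_commute[of _ x])
    have dg: "((\<lambda>s. g (x s)) has_vector_derivative g x') (at t within {0..})"
      if "(x has_vector_derivative x') (at t within {0..})" for x x'
      by (rule bounded_linear.has_vector_derivative[OF blg that])
    have dA: "((\<lambda>s. A *v r s) has_vector_derivative A *v v t) (at t within {0..})"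
      by (rule bounded_linear.has_vector_derivative[OF matrix_vector_mul_bounded_linear dr])
    have dprod: "((\<lambda>s. x s \<bullet> z s) has_real_derivative (x t \<bullet> z' + x' \<bullet> z t)) (at t within {0..})"
      if "(x has_vector_derivative x') (at t within {0..})"
        and "(z has_vector_derivative z') (at t within {0..})" for x z :: "real \<Rightarrow> real ^ 'n" and x' z'
      unfolding has_real_derivative_iff_has_vector_derivative
      by (rule bounded_bilinear.has_vector_derivative[OF bounded_bilinear_inner that])
    have "(E has_real_derivative
        (v t \<bullet> g a + a \<bullet> g (v t)) / 2 + \<beta> / 2 * (r t \<bullet> (A *v v t) + v t \<bullet> (A *v r t))
        + \<gamma> / 2 * (r t \<bullet> g a + v t \<bullet> g (v t))
        + \<gamma>\<^sup>2 / 4 * (r t \<bullet> g (v t) + v t \<bullet> g (r t))) (at t within {0..})"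
      unfolding E_def
      by (rule DERIV_add[OF DERIV_add[OF DERIV_add[OF
            DERIV_cdivide[OF dprod[OF dv dg[OF dv]]] DERIV_cmult[OF dprod[OF dr dA]]]
            DERIV_cmult[OF dprod[OF dr dg[OF dv]]]] DERIV_cmult[OF dprod[OF dr dg[OF dr]]]])
    moreover have "r t \<bullet> (A *v v t) = v t \<bullet> (A *v r t)"
      by (metis inner_symmetric_matrix[OF symA] inner_commute)
    moreover have "v t \<bullet> g a = a \<bullet> g (v t)" "r t \<bullet> g a = a \<bullet> g (r t)"
      "r t \<bullet> g (v t) = v t \<bullet> g (r t)"
      using aV V[OF t] g_sym by auto
    ultimately show ?thesis
      unfolding E'_def
      by (simp add: ag V[OF t]) (simp add: field_simps power2_eq_square)
  qed
  \<comment> \<open>Young's inequality for B, from its nonnegativity at v + \<gamma> r and v -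
    \<gamma> r. Half of the bound is absorbed by the first and last terms of
    \<open>E\<close>.\<close>
  have cross: "\<gamma> * \<bar>r t \<bullet> g (v t)\<bar> \<le> (v t \<bullet> g (v t)) / 2 + \<gamma>\<^sup>2 / 2 * (r t \<bullet> g (r t))"
    if t: "t \<ge> 0" for t
  proof -
    have "0 \<le> (v t + c *\<^sub>R r t) \<bullet> g (v t + c *\<^sub>R r t)" for c
      using V[OF t] subV by (intro g_nonneg subspace_add subspace_scale)
    then have "0 \<le> v t \<bullet> g (v t) + 2 * c * (r t \<bullet> g (v t)) + c\<^sup>2 * (r t \<bullet> g (r t))" for c
      using g_sym[OF V[OF t]]
      by (simp add: linear_add[OF g(1)] linear_scale[OF g(1)] inner_add_left inner_add_right
          algebra_simps power2_eq_square)
    from this[of \<gamma>] this[of "- \<gamma>"] show ?thesis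
      using pos by (auto simp: abs_if)
  qed
  \<comment> \<open>A number, not the inner product B: the coefficients arising in the upper bound
    are summed, so that one constant dominates both the kinetic and the potential part.\<close>
  define B where "B = 1 + \<beta> / 2 + \<gamma>\<^sup>2 / 2 * (K / m)"
  have B: "B > 0"
    unfolding B_def using pos K m by (simp add: add_pos_nonneg)
  have E_upper: "E t \<le> B * (v t \<bullet> g (v t) + r t \<bullet> (A *v r t))" if t: "t \<ge> 0" for t
  proof -
    have nn: "v t \<bullet> g (v t) \<ge> 0" "r t \<bullet> (A *v r t) \<ge> 0"
      using g_nonneg[OF V(2)[OF t]] m(2)[OF V(1)[OF t]] m(1)
      by (auto intro: order_trans[rotated])
    have "\<gamma>\<^sup>2 / 2 * (r t \<bullet> g (r t)) \<le> \<gamma>\<^sup>2 / 2 * (K / m * (r t \<bullet> (A *v r t)))"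
      by (intro mult_left_mono g_le V t) simp
    moreover have "\<gamma> * (r t \<bullet> g (v t)) \<le> \<gamma> * \<bar>r t \<bullet> g (v t)\<bar>"
      using pos by simp
    ultimately have "E t \<le> v t \<bullet> g (v t) + \<beta> / 2 * (r t \<bullet> (A *v r t))
        + \<gamma>\<^sup>2 / 2 * (K / m * (r t \<bullet> (A *v r t)))"
      using cross[OF t] nn unfolding E_def by linarith
    also have "\<dots> \<le> \<dots> + (\<beta> / 2 + \<gamma>\<^sup>2 / 2 * (K / m)) * (v t \<bullet> g (v t)) + r t \<bullet> (A *v r t)"
      using nn pos K m by simp
    also have "\<dots> = B * (v t \<bullet> g (v t) + r t \<bullet> (A *v r t))"
      by (simp add: B_def algebra_simps)
    finally show ?thesis .
  qed
  have E_lower: "\<beta> * m / 2 * (norm (r t))\<^sup>2 \<le> E t" if t: "t \<ge> 0" for t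
  proof -
    have "\<gamma> * \<bar>r t \<bullet> g (v t)\<bar> \<ge> - (\<gamma> * (r t \<bullet> g (v t)))"
      using pos by (simp add: abs_if)
    then have "\<beta> / 2 * (r t \<bullet> (A *v r t)) \<le> E t"
      using cross[OF t] g_nonneg[OF V(2)[OF t]] unfolding E_def by linarith
    moreover have "\<beta> / 2 * (m * (r t \<bullet> r t)) \<le> \<beta> / 2 * (r t \<bullet> (A *v r t))"
      using pos m(2)[OF V(1)[OF t]] by (intro mult_left_mono) auto
    ultimately show ?thesis
      by (simp add: dot_square_norm)
  qed
  \<comment> \<open>The smaller of the two dissipation coefficients in \<open>E'\<close>.\<close>
  define c where "c = min (\<gamma> / 2) (\<gamma> * \<beta> / 2)"
  have c: "c > 0" "c \<le> \<gamma> / 2" "c \<le> \<gamma> * \<beta> / 2"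
    using pos by (auto simp: c_def)
  \<comment> \<open>The energy decays at rate \<open>c / B\<close>; the factor 2 accounts for the
    square root taken to pass to the norm.\<close>
  define \<omega> where "\<omega> = c / (2 * B)"
  have \<omega>: "\<omega> > 0"
    using B c by (simp add: \<omega>_def)
  have decay: "E t \<le> E 0 * exp (- (2 * \<omega>) * t)" if "t \<ge> 0" for t
  proof (rule exp_decay_if_derivative_le[OF E_deriv _ that])
    fix t :: real assume t: "t \<ge> 0"
    have nn: "v t \<bullet> g (v t) \<ge> 0" "r t \<bullet> (A *v r t) \<ge> 0"
      using g_nonneg[OF V(2)[OF t]] m(2)[OF V(1)[OF t]] m(1)
      by (auto intro: order_trans[rotated])
    have "2 * \<omega> * E t \<le> 2 * \<omega> * (B * (v t \<bullet> g (v t) + r t \<bullet> (A *v r t)))"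
      using E_upper[OF t] \<omega> by (intro mult_left_mono) auto
    also have "\<dots> = c * (v t \<bullet> g (v t)) + c * (r t \<bullet> (A *v r t))"
      using B by (simp add: \<omega>_def field_simps)
    also have "\<dots> \<le> - E' t"
      using mult_right_mono[OF c(2) nn(1)] mult_right_mono[OF c(3) nn(2)] by (simp add: E'_def)
    finally show "E' t \<le> - (2 * \<omega>) * E t" by simp
  qed
  \<comment> \<open>The square root comes from \<open>E_lower\<close>; adding 1 keeps
    \<open>M\<close> positive when \<open>E 0\<close> vanishes.\<close>
  define M where "M = sqrt (2 / (\<beta> * m) * E 0) + 1"
  have E0: "E 0 \<ge> 0"
    by (rule order_trans[OF _ E_lower]) (use pos m(1) in auto)
  have "norm (r t) \<le> M * exp (- \<omega> * t)" if t: "t \<ge> 0" for t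
  proof -
    have "(norm (r t))\<^sup>2 = 2 / (\<beta> * m) * (\<beta> * m / 2 * (norm (r t))\<^sup>2)"
      using pos m(1) by simp
    also have "\<dots> \<le> 2 / (\<beta> * m) * (E 0 * exp (- (2 * \<omega>) * t))"
      using pos m(1) order_trans[OF E_lower[OF t] decay[OF t]] by (intro mult_left_mono) auto
    also have "exp (- (2 * \<omega>) * t) = (exp (- \<omega> * t))\<^sup>2"
      by (simp add: exp_double[symmetric])
    also have "2 / (\<beta> * m) * (E 0 * (exp (- \<omega> * t))\<^sup>2) = (sqrt (2 / (\<beta> * m) * E 0) * exp (- \<omega> * t))\<^sup>2"
      using E0 pos m(1) by (simp add: power_mult_distrib)
    finally have "norm (r t) \<le> sqrt (2 / (\<beta> * m) * E 0) * exp (- \<omega> * t)"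
      by (rule power2_le_imp_le) (use E0 pos m(1) in simp)
    also have "\<dots> \<le> M * exp (- \<omega> * t)"
      by (simp add: M_def)
    finally show ?thesis .
  qed
  moreover have "M > 0"
    unfolding M_def using E0 pos m(1) by (intro add_nonneg_pos) auto
  ultimately show ?thesis
    using \<omega> by blast
qed

theorem proposition3p10:
  fixes G :: "real ^ 'd ^ 'k" and \<Gamma> :: "real ^ 'k ^ 'k" and y :: "real ^ 'k"
    and \<gamma> \<beta> k \<alpha> :: real and f :: "real \<Rightarrow> real"
    and A :: "real ^ 'd ^ 'd" and b :: "real ^ 'd"
    and X X' :: "real \<Rightarrow> real ^ 'd ^ 'j" and X_inf :: "real ^ 'd ^ 'j"
    and x_dag :: "real ^ 'd" and xbar xbar' :: "real \<Rightarrow> real ^ 'd"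
  assumes "sym_pos_def \<Gamma>"
    and "A = hess G \<Gamma>" and "b = rhs_vec G \<Gamma> y"
    and "\<gamma> > 0" and "\<beta> > 0" and "k \<ge> 0" and "\<alpha> \<ge> 0"
    and "smooth_halfline f" and "\<And>s. s \<ge> 0 \<Longrightarrow> f s > 0" and "antimono_on {0..} f"
    and "damped_solution \<gamma> (particle_force A b \<beta> k \<alpha> f) X X'"
    and "(X \<longlongrightarrow> X_inf) at_top" and "(X' \<longlongrightarrow> 0) at_top"
    and "pos_def_on A (retained X_inf)"
    and "emp_cov X_inf *v (A *v x_dag - b) = 0"
    and "damped_solution \<gamma> (\<lambda>x. - \<beta> *\<^sub>R (emp_cov X_inf *v (A *v x - b))) xbar xbar'"
    and "xbar 0 - x_dag \<in> retained X_inf" and "xbar' 0 \<in> retained X_inf"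
  shows "(\<forall>t\<ge>0. xbar t - x_dag \<in> retained X_inf) \<and>
    (\<exists>M>0. \<exists>\<omega>>0. \<forall>t\<ge>0. norm (xbar t - x_dag) \<le> M * exp (- \<omega> * t))"
proof -
  let ?C = "emp_cov X_inf"
  define r where "r t = xbar t - x_dag" for t
  have ret: "retained X_inf = range (\<lambda>w. ?C *v w)"
    by (simp add: retained_def)
  \<comment> \<open>Stationarity of \<open>x_dag\<close> makes the force linear in the error, and a
    constant shift leaves the velocity \<open>xbar'\<close> unchanged.\<close>
  have force: "- \<beta> *\<^sub>R (?C *v (A *v x - b)) = - \<beta> *\<^sub>R (?C *v (A *v (x - x_dag)))" for x
    using assms(15) by (simp add: matrix_vector_mult_diff_distrib)
  have sol: "damped_solution \<gamma> (\<lambda>x. - \<beta> *\<^sub>R (?C *v (A *v x))) r xbar'"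
    using assms(16) unfolding damped_solution_def force r_def
    by (auto simp: has_vector_derivative_diff_const)
  \<comment> \<open>The scalar moves inside so that the force visibly takes values in the range of
    \<open>?C\<close>, as the invariance argument expects.\<close>
  then have "damped_solution \<gamma> (\<lambda>x. ?C *v (- \<beta> *\<^sub>R (A *v x))) r xbar'"
    by (simp only: matrix_vector_mult_scaleR)
  note inv = damped_solution_range_invariant[OF transpose_emp_cov this, folded ret]
  have V: "r t \<in> retained X_inf" "xbar' t \<in> retained X_inf" if "t \<ge> 0" for t
    using inv[OF _ _ that] assms(17,18) by (auto simp: r_def)
  have "transpose A = A"
    using assms(1,2) by (simp add: transpose_hess)
  from damped_preconditioned_exp_decay[OF transpose_emp_cov emp_cov_nonneg this _ \<open>\<gamma> > 0\<close> \<open>\<beta> > 0\<close> sol,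
      folded ret, OF assms(14) V]
  show ?thesis
    using V(1) by (simp add: r_def)
qed

end
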